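(* For each integer $k\ge0$, every graph of girth at least $16k+5$ and minimum degree $d\ge2$ contains an induced cycle of length at least $3+d(d-1)^k$. In particular, there is an absolute constant $c>0$ such that if $k\ge1$, every such graph contains an induced cycle of length at least $cd^2$.
   Context: Graphs are finite and simple. The girth of a graph is the length of its shortest cycle (infinite for forests). *)

theory Defs
  imports Complex_Main "HOL-Library.Extended_Nat"
begin

definition simple_graph :: "'a set \<Rightarrow> 'a set set \<Rightarrow> bool" where
  "simple_graph V E \<longleftrightarrow> finite V \<and> (\<forall>e\<in>E. e \<subseteq> V \<and> card e = 2)"

definition degree :: "'a set set \<Rightarrow> 'a \<Rightarrow> nat" where
  "degree E v = card {e \<in> E. v \<in> e}"

(* Unspecified for the null graph, so users must require V to be nonempty. *)
definition min_degree :: "'a set \<Rightarrow> 'a set set \<Rightarrow> nat" where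
  "min_degree V E = Min (degree E ` V)"

(* A cycle is given by the list of its vertices in cyclic order, without
   repeating the first vertex at the end; its length is the length of the list. *)
definition cycle_edges :: "'a list \<Rightarrow> 'a set set" where
  "cycle_edges xs = {{xs ! i, xs ! (Suc i mod length xs)} | i. i < length xs}"

definition is_cycle :: "'a set \<Rightarrow> 'a set set \<Rightarrow> 'a list \<Rightarrow> bool" where
  "is_cycle V E xs \<longleftrightarrow>
     3 \<le> length xs \<and> distinct xs \<and> set xs \<subseteq> V \<and> cycle_edges xs \<subseteq> E"

(* The Inf in enat of the empty set is \<infinity>, so forests have infinite girth. *)
definition girth :: "'a set \<Rightarrow> 'a set set \<Rightarrow> enat" where
  "girth V E = Inf {enat (length xs) | xs. is_cycle V E xs}"

definition induced_edges :: "'a set set \<Rightarrow> 'a set \<Rightarrow> 'a set set" where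
  "induced_edges E S = {e \<in> E. e \<subseteq> S}"

definition is_induced_cycle :: "'a set \<Rightarrow> 'a set set \<Rightarrow> 'a list \<Rightarrow> bool" where
  "is_induced_cycle V E xs \<longleftrightarrow>
     is_cycle V E xs \<and> induced_edges E (set xs) = cycle_edges xs"

end

theory Submission
  imports Defs
begin

text \<open>
  Take a maximal set of centres at pairwise distance more than 2k and grow a breadth-first
  forest from it. Its trees (the cells) have radius at most 2k, and each contains the ball of
  radius k around its centre. Contract the cells: a multiple edge, triangle or quadrilateral of
  the quotient would lift to a closed walk of length at most 4(4k + 1) = 16k + 4 in the graph,
  so the girth excludes it. A cell is a tree of at least as many vertices as the ball, so
  counting degrees shows that at least D = d(d - 1)^k edges leave it, and the quotient has
  minimum degree at least D.

  In a graph without triangles and quadrilaterals, grow an induced path as in Gyarfas' argument,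
  always keeping a connected set C whose only neighbour on the path is the last vertex. When C
  cannot be shrunk further it is a single vertex w, and all neighbours of w are attached to the
  path; their attachment points differ, so one of the resulting induced cycles reaches D steps
  back and has length at least D + 3. An induced cycle of the quotient lifts to one of at least
  the same length.
\<close>

section \<open>Edge sets as symmetric adjacency relations\<close>

definition adj :: "'a set set \<Rightarrow> 'a rel" where
  "adj E = {(u, v). {u, v} \<in> E}"

lemma sym_adj: "sym (adj E)"
  by (auto simp: adj_def sym_def insert_commute)

lemma adj_irrefl: "simple_graph V E \<Longrightarrow> (u, u) \<notin> adj E"
  by (auto simp: adj_def simple_graph_def)

lemma adj_subset: "simple_graph V E \<Longrightarrow> adj E \<subseteq> V \<times> V"
  by (auto simp: adj_def simple_graph_def)

lemma degree_eq_card_adj: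
  assumes "simple_graph V E"
  shows "degree E v = card (adj E `` {v})"
proof -
  have "bij_betw (\<lambda>u. {v, u}) (adj E `` {v}) {e \<in> E. v \<in> e}"
  proof (rule bij_betwI')
    fix x y show "({v, x} = {v, y}) = (x = y)" by (auto simp: doubleton_eq_iff)
  next
    fix x assume "x \<in> adj E `` {v}"
    then show "{v, x} \<in> {e \<in> E. v \<in> e}" by (auto simp: adj_def)
  next
    fix e assume e: "e \<in> {e \<in> E. v \<in> e}"
    then have "card e = 2" using assms by (auto simp: simple_graph_def)
    then obtain x y where "e = {x, y}" by (auto simp: card_2_iff)
    then obtain w where "e = {v, w}" using e by (cases "v = x") (auto simp: insert_commute)
    then show "\<exists>x\<in>adj E `` {v}. e = {v, x}" using e by (auto simp: adj_def)
  qed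
  then show ?thesis unfolding degree_def by (rule bij_betw_same_card[symmetric])
qed

section \<open>Shortest paths and chordless cycles\<close>

text \<open>Stated for a relation, so as to cover both the graph and its quotient. Testing pairs
  \<open>i < j\<close> suffices for symmetric irreflexive relations; the last disjunct is the
  closing edge.\<close>

definition chordless_cycle :: "'a rel \<Rightarrow> 'a list \<Rightarrow> bool" where
  "chordless_cycle A xs \<longleftrightarrow> 3 \<le> length xs \<and> distinct xs \<and>
     (\<forall>i j. i < j \<longrightarrow> j < length xs \<longrightarrow>
        ((xs ! i, xs ! j) \<in> A \<longleftrightarrow> j = Suc i \<or> i = 0 \<and> Suc j = length xs))"

text \<open>Powers of \<open>R\<^sup>=\<close> express "at most n steps": reflexive steps pad a
  walk, and here the padding is removed again.\<close>

lemma relpow_reflcl_bound: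
  assumes "(x, y) \<in> (R\<^sup>=) ^^ n"
  shows "\<exists>m\<le>n. (x, y) \<in> R ^^ m"
  using assms
proof (induction n arbitrary: y)
  case (Suc n)
  then obtain z where z: "(x, z) \<in> (R\<^sup>=) ^^ n" "(z, y) \<in> R\<^sup>=" by auto
  then obtain m where m: "m \<le> n" "(x, z) \<in> R ^^ m" using Suc.IH by blast
  show ?case
  proof (cases "z = y")
    case True then show ?thesis using m by (meson le_SucI)
  next
    case False
    then have "(x, y) \<in> R ^^ Suc m" using m z by auto
    then show ?thesis using m by (meson Suc_le_mono)
  qed
qed auto

lemma relpow_reflcl_mono:
  assumes "(x, y) \<in> (R\<^sup>=) ^^ m" "m \<le> n" "R \<subseteq> S"
  shows "(x, y) \<in> (S\<^sup>=) ^^ n"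
  using assms(2)
proof (induction n rule: dec_induct)
  case base
  have "(R\<^sup>=) ^^ m \<subseteq> (S\<^sup>=) ^^ m"
  proof (induction m)
    case (Suc m)
    have "R\<^sup>= \<subseteq> S\<^sup>=" using assms(3) by auto
    from relcomp_mono[OF Suc this] show ?case unfolding relpow.simps .
  qed simp
  then show ?case using assms(1) by auto
qed auto

lemma relpow_comp: "(x, y) \<in> R ^^ m \<Longrightarrow> (y, z) \<in> R ^^ n \<Longrightarrow> (x, z) \<in> R ^^ (m + n)"
  by (auto simp: relpow_add)

lemma sym_relpow:
  assumes "sym R" shows "sym (R ^^ n)"
proof (induction n)
  case 0 then show ?case by (auto simp: sym_def)
next
  case (Suc n)
  show ?case
  proof (rule symI)
    fix x y assume "(x, y) \<in> R ^^ Suc n"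
    then obtain z where "(x, z) \<in> R ^^ n" "(z, y) \<in> R" by auto
    then have "(y, z) \<in> R" "(z, x) \<in> R ^^ n" using assms Suc by (auto dest: symD)
    then show "(y, x) \<in> R ^^ Suc n" by (rule relpow_Suc_I2)
  qed
qed

lemma relpow_reflcl_stays:
  assumes "A \<subseteq> V \<times> V" "(x, y) \<in> (A\<^sup>=) ^^ n" "x \<in> V"
  shows "y \<in> V"
  using assms(2)
proof (induction n arbitrary: y)
  case (Suc n)
  then obtain z where "(x, z) \<in> (A\<^sup>=) ^^ n" "(z, y) \<in> A\<^sup>=" by auto
  then show ?case using Suc.IH assms(1) by blast
qed (use assms(3) in simp)

lemma funpow_walk:
  assumes "\<And>v. v \<in> V \<Longrightarrow> p v \<in> V \<and> (v, p v) \<in> R" "v \<in> V"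
  shows "(p ^^ n) v \<in> V \<and> (v, (p ^^ n) v) \<in> R ^^ n"
  using assms by (induction n) auto

text \<open>In a walk of least length, a repeated vertex or a forward chord would allow a shortcut
  from a prefix to a suffix.\<close>

lemma shortest_path:
  assumes "(x, y) \<in> R ^^ n"
  obtains ps where "ps \<noteq> []" "length ps \<le> Suc n" "ps ! 0 = x" "last ps = y" "distinct ps"
    "\<forall>i. Suc i < length ps \<longrightarrow> (ps ! i, ps ! Suc i) \<in> R"
    "\<forall>i j. i < j \<longrightarrow> j < length ps \<longrightarrow> (ps ! i, ps ! j) \<in> R \<longrightarrow> j = Suc i"
proof -
  define m where "m = (LEAST m. (x, y) \<in> R ^^ m)"
  have m: "(x, y) \<in> R ^^ m" unfolding m_def by (rule LeastI) (rule assms)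
  have le: "m \<le> l" if "(x, y) \<in> R ^^ l" for l unfolding m_def using that by (rule Least_le)
  obtain g where g: "g 0 = x" "g m = y" "\<And>i. i < m \<Longrightarrow> (g i, g (Suc i)) \<in> R"
    using m unfolding relpow_fun_conv by blast
  have seg: "(g i, g (i + l)) \<in> R ^^ l" if "i + l \<le> m" for i l
    using that
  proof (induction l)
    case (Suc l)
    then have "(g i, g (i + l)) \<in> R ^^ l" "(g (i + l), g (Suc (i + l))) \<in> R" using g(3) by auto
    then show ?case by (simp add: relcomp.relcompI)
  qed simp
  have pre: "(x, g i) \<in> R ^^ i" if "i \<le> m" for i using seg[of 0 i] that g by simp
  have post: "(g i, y) \<in> R ^^ (m - i)" if "i \<le> m" for i using seg[of i "m - i"] that g by simp
  have ne: "g i \<noteq> g j" if "i < j" "j \<le> m" for i j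
  proof
    assume "g i = g j"
    then have "(x, g j) \<in> R ^^ i" using pre[of i] that by simp
    then have "(x, y) \<in> R ^^ (i + (m - j))" using post[OF that(2)] by (rule relpow_comp)
    from le[OF this] that show False by auto
  qed
  have ch: "j = Suc i" if "i < j" "j \<le> m" "(g i, g j) \<in> R" for i j
  proof -
    have "(x, g j) \<in> R ^^ Suc i" using pre[of i] that by auto
    then have "(x, y) \<in> R ^^ (Suc i + (m - j))" using post[OF that(2)] by (rule relpow_comp)
    from le[OF this] that show ?thesis by auto
  qed
  define ps where "ps = map g [0..<Suc m]"
  have len: "length ps = Suc m" by (simp add: ps_def)
  have nth: "ps ! i = g i" if "i \<le> m" for i
    using that unfolding ps_def by (simp del: upt_Suc)
  show ?thesis
  proof (rule that[of ps])
    show "ps \<noteq> []" using len by auto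
    show "length ps \<le> Suc n" using len le[OF assms] by simp
    show "ps ! 0 = x" using nth[of 0] g by simp
    show "last ps = y" using g by (simp add: ps_def)
    show "distinct ps" unfolding distinct_conv_nth len
    proof (intro allI impI)
      fix i j assume "i < Suc m" "j < Suc m" "i \<noteq> j"
      then show "ps ! i \<noteq> ps ! j" using ne[of i j] ne[of j i] nth[of i] nth[of j] by fastforce
    qed
    show "\<forall>i. Suc i < length ps \<longrightarrow> (ps ! i, ps ! Suc i) \<in> R" using g(3) len nth by simp
    show "\<forall>i j. i < j \<longrightarrow> j < length ps \<longrightarrow> (ps ! i, ps ! j) \<in> R \<longrightarrow> j = Suc i"
      using ch len nth by simp
  qed
qed

text \<open>A shortest \<open>R\<close>-path from \<open>b\<close> to \<open>a\<close> has no
  forward chord, so the added edge can only close it. The hypotheses on \<open>a\<close> and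
  \<open>b\<close> force at least three vertices.\<close>

lemma closing_edge_chordless_cycle:
  assumes R: "(b, a) \<in> R ^^ n" and ab: "a \<noteq> b" "(b, a) \<notin> R"
  obtains ps where "length ps \<le> Suc n" "chordless_cycle (R \<union> {(a, b), (b, a)}) ps"
    "ps ! 0 = b" "last ps = a" "\<forall>i. Suc i < length ps \<longrightarrow> (ps ! i, ps ! Suc i) \<in> R"
proof (rule shortest_path[OF R])
  fix ps assume ps: "ps \<noteq> []" "length ps \<le> Suc n" "ps ! 0 = b" "last ps = a" "distinct ps"
    "\<forall>i. Suc i < length ps \<longrightarrow> (ps ! i, ps ! Suc i) \<in> R"
    "\<forall>i j. i < j \<longrightarrow> j < length ps \<longrightarrow> (ps ! i, ps ! j) \<in> R \<longrightarrow> j = Suc i"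
  have last: "ps ! (length ps - 1) = a" using ps by (simp add: last_conv_nth)
  have "length ps \<noteq> 1" using last ps(3) ab by auto
  moreover have "length ps \<noteq> 2"
  proof
    assume "length ps = 2"
    then show False using ps(6) last ps(3) ab by (simp add: numeral_2_eq_2)
  qed
  moreover have "length ps \<noteq> 0" using ps(1) by simp
  ultimately have 3: "3 \<le> length ps" by linarith
  have "(ps ! i, ps ! j) \<in> R \<union> {(a, b), (b, a)} \<longleftrightarrow> j = Suc i \<or> i = 0 \<and> Suc j = length ps"
    if "i < j" "j < length ps" for i j
  proof -
    let ?l = "length ps - 1"
    have l: "?l < length ps" "0 < length ps" using 3 by auto
    have inj: "ps ! x = ps ! y \<longleftrightarrow> x = y" if "x < length ps" "y < length ps" for x y
      using nth_eq_iff_index_eq[OF ps(5) that] .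
    have "ps ! i = b \<longleftrightarrow> i = 0" "ps ! j = b \<longleftrightarrow> j = 0" "ps ! j = a \<longleftrightarrow> j = ?l"
      unfolding ps(3)[symmetric] last[symmetric]
      using inj[of i 0] inj[of j 0] inj[of j ?l] that l by auto
    then have "(ps ! i, ps ! j) \<in> {(a, b), (b, a)} \<longleftrightarrow> i = 0 \<and> Suc j = length ps"
      using that by auto
    moreover have "(ps ! i, ps ! j) \<in> R \<longleftrightarrow> j = Suc i"
      using ps(6,7) that by metis
    ultimately show ?thesis by blast
  qed
  then have "chordless_cycle (R \<union> {(a, b), (b, a)}) ps"
    unfolding chordless_cycle_def using ps(5) 3 by blast
  from that[OF ps(2) this ps(3,4,6)] show thesis .
qed

section \<open>Chordless cycles as induced cycles of a graph\<close>

lemma chordless_cycle_edges: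
  assumes "chordless_cycle (adj E) xs"
  shows "cycle_edges xs = {{xs ! i, xs ! j} | i j. i < j \<and> j < length xs \<and> {xs ! i, xs ! j} \<in> E}"
    (is "_ = ?R")
proof
  let ?n = "length xs"
  have n: "3 \<le> ?n" using assms by (simp add: chordless_cycle_def)
  have adj: "{xs ! i, xs ! j} \<in> E \<longleftrightarrow> j = Suc i \<or> i = 0 \<and> Suc j = ?n" if "i < j" "j < ?n" for i j
    using assms that by (auto simp: chordless_cycle_def adj_def)
  show "cycle_edges xs \<subseteq> ?R"
  proof
    fix e assume "e \<in> cycle_edges xs"
    then obtain i where i: "i < ?n" "e = {xs ! i, xs ! (Suc i mod ?n)}" by (auto simp: cycle_edges_def)
    show "e \<in> ?R"
    proof (cases "Suc i = ?n")
      case True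
      then have "e = {xs ! 0, xs ! i}" using i by (auto simp: insert_commute)
      then show ?thesis using adj[of 0 i] True n by fastforce
    next
      case False
      then have "e = {xs ! i, xs ! Suc i}" "Suc i < ?n" using i by auto
      then show ?thesis using adj[of i "Suc i"] by fastforce
    qed
  qed
  show "?R \<subseteq> cycle_edges xs"
  proof
    fix e assume "e \<in> ?R"
    then obtain i j where ij: "i < j" "j < ?n" "e = {xs ! i, xs ! j}" "e \<in> E" by blast
    then consider "j = Suc i" | "i = 0" "Suc j = ?n" using adj by blast
    then show "e \<in> cycle_edges xs"
    proof cases
      case 1
      then show ?thesis using ij by (auto simp: cycle_edges_def intro!: exI[of _ i])
    next
      case 2
      then have "e = {xs ! j, xs ! (Suc j mod ?n)}" using ij by (auto simp: insert_commute)
      then show ?thesis using ij unfolding cycle_edges_def by blast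
    qed
  qed
qed

lemma chordless_cycle_in_graph:
  assumes "simple_graph V E" "chordless_cycle (adj E) xs"
  shows "set xs \<subseteq> V"
proof
  fix x assume "x \<in> set xs"
  then obtain i where i: "i < length xs" "x = xs ! i" by (auto simp: in_set_conv_nth)
  have "{x, xs ! (Suc i mod length xs)} \<in> cycle_edges xs"
    using i by (auto simp: cycle_edges_def)
  then have "{x, xs ! (Suc i mod length xs)} \<in> E"
    using chordless_cycle_edges[OF assms(2)] by auto
  then show "x \<in> V" using assms(1) by (auto simp: simple_graph_def)
qed

lemma chordless_cycle_is_induced_cycle:
  assumes G: "simple_graph V E" and c: "chordless_cycle (adj E) xs"
  shows "is_induced_cycle V E xs"
proof -
  have sub: "cycle_edges xs \<subseteq> E" using chordless_cycle_edges[OF c] by auto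
  have "is_cycle V E xs"
    using chordless_cycle_in_graph[OF G c] c sub by (simp add: is_cycle_def chordless_cycle_def)
  moreover have "induced_edges E (set xs) = cycle_edges xs"
  proof
    show "cycle_edges xs \<subseteq> induced_edges E (set xs)"
      using sub chordless_cycle_edges[OF c] by (auto simp: induced_edges_def)
    show "induced_edges E (set xs) \<subseteq> cycle_edges xs"
    proof
      fix e assume "e \<in> induced_edges E (set xs)"
      then have e: "e \<in> E" "e \<subseteq> set xs" by (auto simp: induced_edges_def)
      then obtain u v where uv: "e = {u, v}" "u \<noteq> v"
        using G by (auto simp: simple_graph_def card_2_iff)
      then obtain i j where ij: "i < length xs" "j < length xs" "u = xs ! i" "v = xs ! j"
        using e by (auto simp: in_set_conv_nth)
      consider "i < j" | "j < i" using ij uv by (metis linorder_neqE_nat)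
      then show "e \<in> cycle_edges xs"
      proof cases
        case 1
        then show ?thesis using ij uv e unfolding chordless_cycle_edges[OF c] by blast
      next
        case 2
        then have "e = {xs ! j, xs ! i}" using ij uv by auto
        then show ?thesis using 2 ij e unfolding chordless_cycle_edges[OF c] by blast
      qed
    qed
  qed
  ultimately show ?thesis by (simp add: is_induced_cycle_def)
qed

text \<open>The walk may repeat vertices, but it avoids the edge \<open>ab\<close>: a shortest path
  in the graph without that edge closes up with it to a genuine cycle of length at most
  \<open>n + 1\<close>. Every use of the girth goes through this.\<close>

lemma girth_le_closed_walk:
  assumes G: "simple_graph V E" and g: "enat g \<le> girth V E"
    and ab: "(a, b) \<in> adj E"
    and w: "(b, a) \<in> ((adj E - {(a, b), (b, a)})\<^sup>=) ^^ n"
  shows "g \<le> Suc n"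
proof -
  let ?R = "adj E - {(a, b), (b, a)}"
  have ne: "a \<noteq> b" using adj_irrefl[OF G] ab by auto
  have un: "?R \<union> {(a, b), (b, a)} = adj E" using ab symD[OF sym_adj] by auto
  obtain m where m: "m \<le> n" "(b, a) \<in> ?R ^^ m" using relpow_reflcl_bound[OF w] by blast
  have "\<exists>ps. length ps \<le> Suc m \<and> chordless_cycle (adj E) ps"
  proof (rule closing_edge_chordless_cycle[OF m(2) ne])
    fix ps assume "length ps \<le> Suc m" "chordless_cycle (?R \<union> {(a, b), (b, a)}) ps"
    then show ?thesis unfolding un by blast
  qed simp
  then obtain ps where ps: "length ps \<le> Suc m" "chordless_cycle (adj E) ps" by blast
  then have "is_cycle V E ps"
    using chordless_cycle_is_induced_cycle[OF G] by (simp add: is_induced_cycle_def)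
  then have "girth V E \<le> enat (length ps)" unfolding girth_def by (auto intro!: Inf_lower)
  then have "enat g \<le> enat (length ps)" using g by order
  then show ?thesis using ps m by simp
qed

section \<open>Induced cycles in graphs without triangles and quadrilaterals\<close>

text \<open>The head of the list is the end at which paths grow.\<close>

definition induced_path :: "'a rel \<Rightarrow> 'a list \<Rightarrow> bool" where
  "induced_path A vs \<longleftrightarrow> distinct vs \<and>
     (\<forall>i j. i < j \<longrightarrow> j < length vs \<longrightarrow> ((vs ! i, vs ! j) \<in> A \<longleftrightarrow> j = Suc i))"

lemma induced_path_Cons:
  assumes p: "induced_path A (v # vs)" and z: "z \<notin> set (v # vs)" "(z, v) \<in> A" "\<forall>x\<in>set vs. (z, x) \<notin> A"
  shows "induced_path A (z # v # vs)"
  unfolding induced_path_def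
proof (intro conjI allI impI)
  show "distinct (z # v # vs)" using p z(1) by (simp add: induced_path_def)
  fix i j assume ij: "i < j" "j < length (z # v # vs)"
  then obtain j' where j': "j = Suc j'" "j' < length (v # vs)" by (cases j) auto
  show "((z # v # vs) ! i, (z # v # vs) ! j) \<in> A \<longleftrightarrow> j = Suc i"
  proof (cases i)
    case 0
    then show ?thesis using j' z(2,3) by (cases j') auto
  next
    case (Suc i')
    then have "((v # vs) ! i', (v # vs) ! j') \<in> A \<longleftrightarrow> j' = Suc i'"
      using p ij j' unfolding induced_path_def by blast
    then show ?thesis using Suc j' by simp
  qed
qed

text \<open>\<open>u\<close> may have more neighbours beyond index \<open>n\<close>, because the
  path is cut off there.\<close>

lemma induced_path_close:
  assumes p: "induced_path A ws" and u: "u \<notin> set ws" and n: "0 < n" "n < length ws"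
    and adj: "(u, ws ! 0) \<in> A" "(u, ws ! n) \<in> A" "\<forall>i. 0 < i \<and> i < n \<longrightarrow> (u, ws ! i) \<notin> A"
  shows "chordless_cycle A (u # take (Suc n) ws)"
  unfolding chordless_cycle_def
proof (intro conjI allI impI)
  let ?cs = "u # take (Suc n) ws"
  have len: "length ?cs = n + 2" using n by simp
  show "3 \<le> length ?cs" using n len by linarith
  show "distinct ?cs" using p u by (auto simp: induced_path_def dest: in_set_takeD)
  fix i j assume ij: "i < j" "j < length ?cs"
  then obtain j' where j': "j = Suc j'" "j' \<le> n" using len by (cases j) auto
  show "(?cs ! i, ?cs ! j) \<in> A \<longleftrightarrow> j = Suc i \<or> i = 0 \<and> Suc j = length ?cs"
  proof (cases i)
    case 0
    consider "j' = 0" | "j' = n" | "0 < j'" "j' < n" using j' by linarith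
    then have "(u, ws ! j') \<in> A \<longleftrightarrow> j' = 0 \<or> j' = n" using adj by cases auto
    then show ?thesis using 0 j' len by simp
  next
    case (Suc i')
    then have "i' < j'" "j' < length ws" using ij(1) j' n by auto
    then have "(ws ! i', ws ! j') \<in> A \<longleftrightarrow> j' = Suc i'"
      using p unfolding induced_path_def by blast
    then show ?thesis using Suc ij j' by simp
  qed
qed

text \<open>\<open>C\<close> is the component of \<open>y\<close> in the subgraph induced by
  \<open>B\<close>. A walk in \<open>B\<close> from \<open>y\<close> never leaves \<open>C\<close>,
  so \<open>C\<close> is connected through its own vertices.\<close>

lemma component_within:
  assumes A: "sym A" and y: "y \<in> B" and C: "C = (A \<inter> B \<times> B)\<^sup>* `` {y}"
  shows "C \<subseteq> B" and "y \<in> C"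
    and "p \<in> C \<Longrightarrow> (p, q) \<in> A \<Longrightarrow> q \<in> B \<Longrightarrow> q \<in> C"
    and "\<forall>p\<in>C. \<forall>q\<in>C. (p, q) \<in> (A \<inter> C \<times> C)\<^sup>*"
proof -
  show CB: "C \<subseteq> B"
  proof
    fix z assume "z \<in> C"
    then have "(y, z) \<in> (A \<inter> B \<times> B)\<^sup>*" by (simp add: C)
    then show "z \<in> B" using y by (cases rule: rtranclE) auto
  qed
  show yC: "y \<in> C" by (simp add: C)
  have closed: "q \<in> C" if "p \<in> C" "(p, q) \<in> A" "q \<in> B" for p q
    using that CB unfolding C by (auto intro: rtrancl_into_rtrancl)
  then show "p \<in> C \<Longrightarrow> (p, q) \<in> A \<Longrightarrow> q \<in> B \<Longrightarrow> q \<in> C" .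
  have y_to: "(y, p) \<in> (A \<inter> C \<times> C)\<^sup>*" if "p \<in> C" for p
  proof -
    have "(y, p) \<in> (A \<inter> B \<times> B)\<^sup>*" using that by (simp add: C)
    then have "p \<in> C \<and> (y, p) \<in> (A \<inter> C \<times> C)\<^sup>*"
    proof induction
      case base then show ?case using yC by simp
    next
      case (step p q)
      then have "q \<in> C" using closed by blast
      then show ?case using step by (auto intro: rtrancl_into_rtrancl)
    qed
    then show ?thesis by blast
  qed
  have "sym (A \<inter> C \<times> C)" using A by (auto simp: sym_def)
  then have "sym ((A \<inter> C \<times> C)\<^sup>*)" by (rule sym_rtrancl)
  then show "\<forall>p\<in>C. \<forall>q\<in>C. (p, q) \<in> (A \<inter> C \<times> C)\<^sup>*"
    using y_to by (meson rtrancl_trans symD)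
qed

text \<open>In this form \<open>no_c4\<close> says that two distinct vertices have at most one
  common neighbour; degenerate closed walks of length 4 remain possible.\<close>

locale c3_c4_free =
  fixes A :: "'a rel" and V :: "'a set" and D :: nat
  assumes finite_V: "finite V"
    and A_subset: "A \<subseteq> V \<times> V"
    and sym_A: "sym A"
    and irrefl_A: "(x, x) \<notin> A"
    and no_triangle: "(x, y) \<in> A \<Longrightarrow> (y, z) \<in> A \<Longrightarrow> (x, z) \<notin> A"
    and no_c4: "(x, y) \<in> A \<Longrightarrow> (y, z) \<in> A \<Longrightarrow> (z, t) \<in> A \<Longrightarrow> (t, x) \<in> A \<Longrightarrow> x = z \<or> y = t"
    and degree_ge: "x \<in> V \<Longrightarrow> D \<le> card (A `` {x})"
    and D_ge: "2 \<le> D"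
begin

lemma A_sym: "(x, y) \<in> A \<Longrightarrow> (y, x) \<in> A"
  using sym_A by (rule symD)

lemma finite_nbhd: "finite (A `` {x})"
  by (rule finite_subset[OF _ finite_V]) (use A_subset in auto)

(* Each further neighbour u of w is joined to the path; no_c4 makes its first
   attachment index injective in u, so some index is at least D. *)
lemma long_cycle_at_dead_end:
  assumes p: "induced_path A (v # rest)" and w: "w \<notin> set (v # rest)" "(w, v) \<in> A"
    and wr: "\<forall>x\<in>set rest. (w, x) \<notin> A"
    and dom: "\<forall>u. (w, u) \<in> A \<longrightarrow> u = v \<or> (\<exists>x\<in>set rest. (u, x) \<in> A)"
  shows "\<exists>cs. chordless_cycle A cs \<and> D + 3 \<le> length cs"
proof -
  let ?vs = "v # rest"
  define U where "U = A `` {w} - {v}"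
  define m where "m u = (LEAST j. j < length ?vs \<and> (u, ?vs ! j) \<in> A)" for u
  have U: "(w, u) \<in> A" "u \<noteq> v" if "u \<in> U" for u using that by (auto simp: U_def)
  have m: "m u < length ?vs" "(u, ?vs ! m u) \<in> A" if u: "u \<in> U" for u
  proof -
    obtain x where "x \<in> set rest" "(u, x) \<in> A" using dom U[OF u] by blast
    then have "\<exists>j. j < length ?vs \<and> (u, ?vs ! j) \<in> A"
      by (metis in_set_conv_nth list.set_intros(2))
    from LeastI_ex[OF this] show "m u < length ?vs" "(u, ?vs ! m u) \<in> A" by (simp_all only: m_def)
  qed
  have m_first: "(u, ?vs ! j) \<notin> A" if "j < m u" "u \<in> U" for j u
  proof
    assume "(u, ?vs ! j) \<in> A"
    then have "m u \<le> j" unfolding m_def using m(1)[OF that(2)] that(1) by (intro Least_le) auto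
    then show False using that by simp
  qed
  \<comment> \<open>Attachment at index 0 would close a triangle with \<open>w\<close> and
    \<open>v\<close>, at index 1 a quadrilateral.\<close>
  have m2: "2 \<le> m u" if "u \<in> U" for u
  proof -
    have "m u \<noteq> 0"
    proof
      assume "m u = 0"
      then have "(u, v) \<in> A" using m(2)[OF that] by simp
      then show False using no_triangle[OF U(1)[OF that]] w(2) by blast
    qed
    moreover have "m u \<noteq> 1"
    proof
      assume 1: "m u = 1"
      have l: "1 < length ?vs" and a: "(u, ?vs ! 1) \<in> A" using m[OF that] unfolding 1 .
      have "(v, ?vs ! 1) \<in> A" using p l unfolding induced_path_def
        by (metis One_nat_def nth_Cons_0 zero_less_one)
      then have "(?vs ! 1, v) \<in> A" by (rule A_sym)
      from no_c4[OF U(1)[OF that] a this A_sym[OF w(2)]] have "w = ?vs ! 1" using U(2)[OF that] by simp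
      then show False using w(1) l nth_mem by metis
    qed
    ultimately show ?thesis by linarith
  qed
  have inj: "inj_on m U"
  proof (rule inj_onI)
    fix u u' assume u: "u \<in> U" "u' \<in> U" "m u = m u'"
    have "w \<noteq> ?vs ! m u" using w(1) m(1)[OF u(1)] nth_mem by metis
    moreover have "(?vs ! m u, u') \<in> A" using m(2)[OF u(2)] u(3) A_sym by simp
    ultimately show "u = u'"
      using no_c4[OF U(1)[OF u(1)] m(2)[OF u(1)] _ A_sym[OF U(1)[OF u(2)]]] by blast
  qed
  \<comment> \<open>Pigeonhole: \<open>U\<close> has at least \<open>D - 1\<close> elements, whereas
    only \<open>D - 2\<close> indices lie in \<open>{2..<D}\<close>.\<close>
  have "\<exists>u\<in>U. D \<le> m u"
  proof (rule ccontr)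
    assume "\<not> ?thesis"
    then have "m ` U \<subseteq> {2..<D}" using m2 by (auto simp: not_le)
    then have "card (m ` U) \<le> card {2..<D}" by (intro card_mono) auto
    then have "card U \<le> D - 2" using card_image[OF inj] by simp
    moreover have "D - 1 \<le> card U"
    proof -
      have "D \<le> card (A `` {w})" using degree_ge w(2) A_subset by auto
      also have "\<dots> - 1 = card U" unfolding U_def using w(2) finite_nbhd by (subst card_Diff_singleton) auto
      finally show ?thesis by linarith
    qed
    ultimately show False using D_ge by linarith
  qed
  then obtain u where u: "u \<in> U" "D \<le> m u" by blast
  have "u \<notin> set (w # ?vs)" using U[OF u(1)] wr irrefl_A by auto
  moreover have "(u, (w # ?vs) ! i) \<notin> A" if "0 < i" "i < Suc (m u)" for i
    using that m_first[OF _ u(1), of "i - 1"] by (cases i) auto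
  \<comment> \<open>The cycle is \<open>u\<close>, \<open>w\<close> and the path from
    \<open>v\<close> to index \<open>m u\<close>, hence has \<open>m u + 3\<close> vertices.\<close>
  ultimately have "chordless_cycle A (u # take (Suc (Suc (m u))) (w # ?vs))"
    using induced_path_close[OF induced_path_Cons[OF p w wr], of u "Suc (m u)"]
      m[OF u(1)] A_sym[OF U(1)[OF u(1)]] by auto
  moreover have "D + 3 \<le> length (u # take (Suc (Suc (m u))) (w # ?vs))"
    using u m(1)[OF u(1)] by simp
  ultimately show ?thesis by blast
qed

text \<open>Induction on the connected set \<open>C\<close> still open to the path. The last
  hypothesis is the bookkeeping: a neighbour of \<open>C\<close> outside \<open>C\<close> is the
  head \<open>v\<close> or is attached to an earlier path vertex. At a dead end it supplies the
  attachments.\<close>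

lemma long_cycle_from_path:
  assumes "finite C" "induced_path A (v # rest)" "C \<subseteq> V" "C \<inter> set (v # rest) = {}"
    and "\<forall>x\<in>C. \<forall>y\<in>C. (x, y) \<in> (A \<inter> C \<times> C)\<^sup>*"
    and "\<forall>x\<in>C. \<forall>y\<in>set rest. (x, y) \<notin> A"
    and "\<exists>x\<in>C. (x, v) \<in> A"
    and "\<forall>x\<in>C. \<forall>y. (x, y) \<in> A \<longrightarrow> y \<in> C \<or> y = v \<or> (\<exists>z\<in>set rest. (y, z) \<in> A)"
  shows "\<exists>cs. chordless_cycle A cs \<and> D + 3 \<le> length cs"
  using assms
proof (induction arbitrary: v rest rule: finite_psubset_induct)
  case (psubset C)
  note path = psubset.prems(1) and CV = psubset.prems(2) and disj = psubset.prems(3)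
    and conn = psubset.prems(4) and far = psubset.prems(5) and near = psubset.prems(6)
    and closed = psubset.prems(7)
  let ?N = "A `` {v}"
  obtain x0 where x0: "x0 \<in> C" "(x0, v) \<in> A" using near by blast
  show ?case
  proof (cases "C \<subseteq> ?N")
    case True
    \<comment> \<open>A second vertex would, by connectedness, give \<open>x0\<close> a neighbour in
      \<open>C\<close>, which forms a triangle with \<open>x0\<close> and \<open>v\<close>.\<close>
    have "C = {x0}"
    proof (rule ccontr)
      assume "C \<noteq> {x0}"
      then obtain y where y: "y \<in> C" "y \<noteq> x0" using x0(1) by blast
      then obtain z where "(x0, z) \<in> A \<inter> C \<times> C" using conn x0(1) by (metis converse_rtranclE)
      then have "(x0, z) \<in> A" "(v, z) \<in> A" using True by auto
      then show False using no_triangle[OF A_sym[OF x0(2)]] by blast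
    qed
    then have "\<forall>u. (x0, u) \<in> A \<longrightarrow> u = v \<or> (\<exists>x\<in>set rest. (u, x) \<in> A)"
      using closed irrefl_A by auto
    then show ?thesis using long_cycle_at_dead_end[OF path _ x0(2)] disj x0(1) far by blast
  next
    case False
    then obtain y where y: "y \<in> C" "y \<notin> ?N" by blast
    \<comment> \<open>The path is to advance into \<open>C\<close> through a neighbour of
      \<open>v\<close>; all neighbours of \<open>v\<close> are then barred, and one remaining
      component is kept.\<close>
    define B where "B = C - ?N"
    define C' where "C' = (A \<inter> B \<times> B)\<^sup>* `` {y}"
    have yB: "y \<in> B" using y by (simp add: B_def)
    note C'B = component_within(1)[OF sym_A yB C'_def] and yC' = component_within(2)[OF sym_A yB C'_def]
      and step = component_within(3)[OF sym_A yB C'_def] and conn' = component_within(4)[OF sym_A yB C'_def]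
    \<comment> \<open>Otherwise the walk in \<open>C\<close> from \<open>y\<close> to
      \<open>x0\<close> would stay in \<open>C'\<close>, which contains no neighbour of
      \<open>v\<close>.\<close>
    have "\<exists>z\<in>C'. \<exists>z'\<in>C \<inter> ?N. (z, z') \<in> A"
    proof (rule ccontr)
      assume no: "\<not> ?thesis"
      have "(y, x0) \<in> (A \<inter> C \<times> C)\<^sup>*" using conn y(1) x0(1) by blast
      then have "x0 \<in> C'"
      proof induction
        case base then show ?case by (rule yC')
      next
        case (step p q)
        then have "q \<in> B" using no by (auto simp: B_def)
        then show ?case using step component_within(3)[OF sym_A yB C'_def] by blast
      qed
      then show False using C'B x0(2) A_sym by (auto simp: B_def)
    qed
    then obtain z z' where z: "z \<in> C'" "z' \<in> C" "(v, z') \<in> A" "(z, z') \<in> A" by auto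
    have *: "\<forall>x\<in>C'. x \<in> C \<and> (x, v) \<notin> A" using C'B A_sym by (auto simp: B_def)
    have "C' \<subset> C" using * x0 by blast
    moreover have "induced_path A (z' # v # rest)"
      using induced_path_Cons[OF path _ A_sym[OF z(3)]] disj far z(2) by blast
    moreover have "C' \<subseteq> V" using * CV by blast
    moreover have "z' \<notin> C'" using * z(3) A_sym by blast
    then have "C' \<inter> set (z' # v # rest) = {}" using * disj by auto
    moreover have "\<forall>p\<in>C'. \<forall>q\<in>C'. (p, q) \<in> (A \<inter> C' \<times> C')\<^sup>*" by (rule conn')
    moreover have "\<forall>x\<in>C'. \<forall>q\<in>set (v # rest). (x, q) \<notin> A" using * far by auto
    moreover have "\<exists>x\<in>C'. (x, z') \<in> A" using z by blast
    \<comment> \<open>A neighbour of \<open>C'\<close> that lies in \<open>C\<close> but not in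
      \<open>C'\<close> must be adjacent to \<open>v\<close>, which has now become an earlier path
      vertex.\<close>
    moreover have "\<forall>x\<in>C'. \<forall>q. (x, q) \<in> A \<longrightarrow> q \<in> C' \<or> q = z' \<or> (\<exists>t\<in>set (v # rest). (q, t) \<in> A)"
    proof (intro ballI allI impI)
      fix x q assume x: "x \<in> C'" "(x, q) \<in> A"
      then have "q \<noteq> v" using * by blast
      then consider "q \<in> C" | t where "t \<in> set rest" "(q, t) \<in> A" using closed x * by blast
      then show "q \<in> C' \<or> q = z' \<or> (\<exists>t\<in>set (v # rest). (q, t) \<in> A)"
      proof cases
        case 1
        show ?thesis
        proof (cases "(q, v) \<in> A")
          case False
          then have "q \<in> B" using 1 A_sym by (auto simp: B_def)
          then show ?thesis using step x by blast
        qed simp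
      qed auto
    qed
    ultimately show ?thesis by (rule psubset.IH)
  qed
qed

lemma ex_long_chordless_cycle:
  assumes "V \<noteq> {}"
  shows "\<exists>cs. chordless_cycle A cs \<and> D + 3 \<le> length cs"
proof -
  obtain v where v: "v \<in> V" using assms by blast
  have "A `` {v} \<noteq> {}" using degree_ge[OF v] D_ge by auto
  then obtain x where x: "(v, x) \<in> A" by blast
  define B where "B = V - {v}"
  define C where "C = (A \<inter> B \<times> B)\<^sup>* `` {x}"
  have xB: "x \<in> B" using x A_subset irrefl_A by (auto simp: B_def)
  note CB = component_within(1)[OF sym_A xB C_def] and xC = component_within(2)[OF sym_A xB C_def]
    and step = component_within(3)[OF sym_A xB C_def] and conn = component_within(4)[OF sym_A xB C_def]
  show ?thesis
  proof (rule long_cycle_from_path[of C v "[]"])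
    show "finite C" using CB finite_V by (auto simp: B_def intro: finite_subset)
    show "induced_path A [v]" by (simp add: induced_path_def)
    show "C \<subseteq> V" "C \<inter> set [v] = {}" using CB by (auto simp: B_def)
    show "\<forall>x\<in>C. \<forall>y\<in>C. (x, y) \<in> (A \<inter> C \<times> C)\<^sup>*" by (rule conn)
    show "\<exists>x\<in>C. (x, v) \<in> A" using A_sym[OF x] xC by blast
    show "\<forall>x\<in>C. \<forall>y. (x, y) \<in> A \<longrightarrow> y \<in> C \<or> y = v \<or> (\<exists>z\<in>set []. (y, z) \<in> A)"
      using step A_subset by (auto simp: B_def)
  qed simp
qed

end

section \<open>Contracting cells\<close>

text \<open>\<open>p\<close> is the parent map of the forest; since it fixes the centres, iterating
  beyond the depth of a vertex is harmless. \<open>p_ball\<close> expresses that a ball of radius at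
  most \<open>k\<close> around a centre lies in its cell, with depth at most the radius.\<close>

locale cells =
  fixes V :: "'a set" and E and k :: nat and X and p :: "'a \<Rightarrow> 'a"
  assumes G: "simple_graph V E"
    and girth_ge: "enat (16 * k + 5) \<le> girth V E"
    and X_subset: "X \<subseteq> V"
    and p_fixed: "x \<in> X \<Longrightarrow> p x = x"
    and p_edge: "v \<in> V \<Longrightarrow> v \<notin> X \<Longrightarrow> (v, p v) \<in> adj E"
    and p_reaches: "v \<in> V \<Longrightarrow> (p ^^ (2 * k)) v \<in> X"
    and p_ball: "x \<in> X \<Longrightarrow> j \<le> k \<Longrightarrow> (x, v) \<in> ((adj E)\<^sup>=) ^^ j \<Longrightarrow> (p ^^ j) v = x"
begin

abbreviation A :: "'a rel" where "A \<equiv> adj E"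

definition centre :: "'a \<Rightarrow> 'a" where
  "centre v = (p ^^ (2 * k)) v"

definition forest :: "'a rel" where
  "forest = {(v, p v) | v. v \<in> V - X} \<union> {(p v, v) | v. v \<in> V - X}"

text \<open>Each cell is represented by its centre. A relation merges parallel edges, so counting
  degrees needs \<open>edge_between_cells_unique\<close>.\<close>

definition quot :: "'a rel" where
  "quot = {(c, c'). c \<noteq> c' \<and> (\<exists>u v. (u, v) \<in> A \<and> centre u = c \<and> centre v = c')}"

lemma finite_V: "finite V"
  using G by (simp add: simple_graph_def)

lemma A_in_V: "(u, v) \<in> A \<Longrightarrow> u \<in> V" "(u, v) \<in> A \<Longrightarrow> v \<in> V"
  using adj_subset[OF G] by auto

lemma A_sym: "(u, v) \<in> A \<Longrightarrow> (v, u) \<in> A"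
  by (rule symD[OF sym_adj])

lemma p_in_V: "v \<in> V \<Longrightarrow> p v \<in> V"
  using p_fixed p_edge A_in_V(2) by (cases "v \<in> X") auto

lemma centre_in_X: "v \<in> V \<Longrightarrow> centre v \<in> X"
  by (simp add: centre_def p_reaches)

lemma funpow_p_fixed: "x \<in> X \<Longrightarrow> (p ^^ n) x = x"
  by (induction n) (auto simp: p_fixed)

lemma centre_p: "v \<in> V \<Longrightarrow> centre (p v) = centre v"
  using p_fixed[OF centre_in_X[of v]] by (simp add: centre_def funpow_swap1)

lemma forest_sym: "sym forest"
  by (auto simp: forest_def sym_def)

lemma forest_subset: "forest \<subseteq> A"
  using p_edge A_sym by (auto simp: forest_def)

lemma forest_centre: "(u, v) \<in> forest \<Longrightarrow> centre u = centre v"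
  by (auto simp: forest_def centre_p)

lemma walk_to_iterate: "v \<in> V \<Longrightarrow> (v, (p ^^ n) v) \<in> (forest\<^sup>=) ^^ n"
  using funpow_walk[of V p "forest\<^sup>="] p_in_V p_fixed by (auto simp: forest_def)

text \<open>Up to the common centre and down again, at most \<open>2 * k\<close> steps each
  way.\<close>

lemma walk_in_cell:
  assumes "u \<in> V" "v \<in> V" "centre u = centre v"
  shows "(u, v) \<in> (forest\<^sup>=) ^^ (4 * k)"
proof -
  have "sym (forest\<^sup>=)" using forest_sym by (auto simp: sym_def)
  then have "(centre v, v) \<in> (forest\<^sup>=) ^^ (2 * k)"
    using symD[OF sym_relpow walk_to_iterate[OF assms(2)]] by (simp add: centre_def)
  moreover have "(u, centre v) \<in> (forest\<^sup>=) ^^ (2 * k)"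
    using walk_to_iterate[OF assms(1), of "2 * k"] assms(3) by (simp add: centre_def)
  ultimately have "(u, v) \<in> (forest\<^sup>=) ^^ (2 * k + 2 * k)" by (rule relpow_comp[rotated])
  then show ?thesis by simp
qed

lemma walk_in_cell_avoiding:
  assumes "u \<in> V" "v \<in> V" "centre u = centre v" "(a, b) \<notin> forest"
  shows "(u, v) \<in> ((A - {(a, b), (b, a)})\<^sup>=) ^^ (4 * k)"
proof -
  have "forest \<subseteq> A - {(a, b), (b, a)}" using forest_subset forest_sym assms(4) by (auto dest: symD)
  with walk_in_cell[OF assms(1-3)] show ?thesis by (rule relpow_reflcl_mono[OF _ order_refl])
qed

lemma no_short_detour:
  assumes "(a, b) \<in> A" "(b, a) \<in> ((A - {(a, b), (b, a)})\<^sup>=) ^^ n"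
  shows "16 * k + 5 \<le> Suc n"
  using girth_le_closed_walk[OF G girth_ge assms] .

text \<open>A further edge would close a cycle of length at most \<open>4 * k + 1\<close> with the
  walk through the centre.\<close>

lemma edge_in_cell:
  assumes "(u, v) \<in> A" "centre u = centre v"
  shows "(u, v) \<in> forest"
proof (rule ccontr)
  assume "(u, v) \<notin> forest"
  then have "(v, u) \<in> ((A - {(u, v), (v, u)})\<^sup>=) ^^ (4 * k)"
    using walk_in_cell_avoiding assms A_in_V by metis
  from no_short_detour[OF assms(1) this] show False by simp
qed

text \<open>Two such edges and a walk in each of the two cells would give a closed walk of length at
  most \<open>8 * k + 2\<close>.\<close>

lemma edge_between_cells_unique:
  assumes e: "(u, v) \<in> A" "(u', v') \<in> A"
    and c: "centre u = centre u'" "centre v = centre v'" "centre u \<noteq> centre v"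
  shows "u = u' \<and> v = v'"
proof (rule ccontr)
  assume ne: "\<not> ?thesis"
  let ?R = "A - {(u, v), (v, u)}"
  have nf: "(u, v) \<notin> forest" using forest_centre c(3) by blast
  have "(v', u') \<in> ?R" using A_sym[OF e(2)] ne c by auto
  moreover have "(v, v') \<in> (?R\<^sup>=) ^^ (4 * k)" "(u', u) \<in> (?R\<^sup>=) ^^ (4 * k)"
    using walk_in_cell_avoiding[OF _ _ _ nf] e A_in_V c by metis+
  ultimately have "(v, u) \<in> (?R\<^sup>=) ^^ (Suc (4 * k) + 4 * k)"
    by (intro relpow_comp[of v u']) auto
  from no_short_detour[OF e(1) this] show False by simp
qed

section \<open>Short cycles in the quotient\<close>

lemma quot_subset: "quot \<subseteq> X \<times> X"
  using centre_in_X A_in_V by (auto simp: quot_def)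

lemma sym_quot: "sym quot"
  unfolding quot_def sym_def using A_sym by blast

text \<open>Lifts one quotient edge: cross the cell to the right exit, then take the edge. Crossing
  uses forest edges and the exit joins another pair of cells, so \<open>ab\<close> is
  avoided.\<close>

lemma quot_step:
  assumes q: "(c, c') \<in> quot" and v: "v \<in> V" "centre v = c"
    and ab: "centre a \<noteq> centre b" "{c, c'} \<noteq> {centre a, centre b}"
  shows "\<exists>v'\<in>V. centre v' = c' \<and> (v, v') \<in> ((A - {(a, b), (b, a)})\<^sup>=) ^^ Suc (4 * k)"
proof -
  obtain u u' where u: "(u, u') \<in> A" "centre u = c" "centre u' = c'" using q by (auto simp: quot_def)
  have "(a, b) \<notin> forest" using forest_centre ab(1) by blast
  then have "(v, u) \<in> ((A - {(a, b), (b, a)})\<^sup>=) ^^ (4 * k)"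
    using walk_in_cell_avoiding v u A_in_V by metis
  moreover have "(u, u') \<in> A - {(a, b), (b, a)}" using u ab(2) by (auto simp: insert_commute)
  ultimately show ?thesis using u A_in_V by auto
qed

text \<open>The edge \<open>ab\<close> realises one side of the triangle; the lifted closed walk has
  length at most \<open>3 * (4 * k + 1)\<close>.\<close>

lemma quot_no_triangle:
  assumes q: "(x, y) \<in> quot" "(y, z) \<in> quot"
  shows "(x, z) \<notin> quot"
proof
  assume "(x, z) \<in> quot"
  then obtain b a where e: "(a, b) \<in> A" "centre a = z" "centre b = x" and ne: "x \<noteq> z"
    using A_sym by (auto simp: quot_def)
  let ?R = "(A - {(a, b), (b, a)})\<^sup>="
  have V: "a \<in> V" "b \<in> V" using e A_in_V by auto
  have xyz: "x \<noteq> y" "y \<noteq> z" using q by (auto simp: quot_def)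
  obtain v where v: "v \<in> V" "centre v = y" "(b, v) \<in> ?R ^^ Suc (4 * k)"
    using quot_step[OF q(1) V(2) e(3), of a b] e ne xyz by (auto simp: doubleton_eq_iff)
  obtain w where w: "w \<in> V" "centre w = z" "(v, w) \<in> ?R ^^ Suc (4 * k)"
    using quot_step[OF q(2) v(1,2), of a b] e ne xyz by (auto simp: doubleton_eq_iff)
  have "(a, b) \<notin> forest" using forest_centre[of a b] e ne by auto
  then have "(w, a) \<in> ?R ^^ (4 * k)" using walk_in_cell_avoiding[OF w(1) V(1)] w e by simp
  with relpow_comp[OF v(3) w(3)] have "(b, a) \<in> ?R ^^ (Suc (4 * k) + Suc (4 * k) + 4 * k)"
    by (rule relpow_comp)
  from no_short_detour[OF e(1) this] show False by simp
qed

text \<open>The lifted closed walk has length at most \<open>4 * (4 * k + 1)\<close>, just below the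
  girth bound: this case dictates the constant \<open>16 * k + 5\<close>.\<close>

lemma quot_no_c4:
  assumes q: "(x, y) \<in> quot" "(y, z) \<in> quot" "(z, t) \<in> quot" "(t, x) \<in> quot"
  shows "x = z \<or> y = t"
proof (rule ccontr)
  assume ne: "\<not> ?thesis"
  obtain a b where e: "(a, b) \<in> A" "centre a = t" "centre b = x"
    using q(4) by (auto simp: quot_def)
  let ?R = "(A - {(a, b), (b, a)})\<^sup>="
  have V: "a \<in> V" "b \<in> V" using e A_in_V by auto
  have d: "x \<noteq> y" "y \<noteq> z" "z \<noteq> t" "t \<noteq> x" using q by (auto simp: quot_def)
  obtain u where u: "u \<in> V" "centre u = y" "(b, u) \<in> ?R ^^ Suc (4 * k)"
    using quot_step[OF q(1) V(2) e(3), of a b] e ne d by (auto simp: doubleton_eq_iff)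
  obtain v where v: "v \<in> V" "centre v = z" "(u, v) \<in> ?R ^^ Suc (4 * k)"
    using quot_step[OF q(2) u(1,2), of a b] e ne d by (auto simp: doubleton_eq_iff)
  obtain w where w: "w \<in> V" "centre w = t" "(v, w) \<in> ?R ^^ Suc (4 * k)"
    using quot_step[OF q(3) v(1,2), of a b] e ne d by (auto simp: doubleton_eq_iff)
  have "(a, b) \<notin> forest" using forest_centre[of a b] e d by auto
  then have "(w, a) \<in> ?R ^^ (4 * k)" using walk_in_cell_avoiding[OF w(1) V(1)] w e by simp
  with relpow_comp[OF relpow_comp[OF u(3) v(3)] w(3)]
  have "(b, a) \<in> ?R ^^ (Suc (4 * k) + Suc (4 * k) + Suc (4 * k) + 4 * k)"
    by (rule relpow_comp)
  from no_short_detour[OF e(1) this] show False by simp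
qed

section \<open>Cell sizes and quotient degrees\<close>

definition layer :: "'a \<Rightarrow> nat \<Rightarrow> 'a set" where
  "layer x j = {v \<in> V. (p ^^ j) v = x}"

lemma finite_layer: "finite (layer x j)"
  using finite_V by (simp add: layer_def)

lemma centre_in_layer: "x \<in> X \<Longrightarrow> x \<in> layer x j"
  using X_subset by (auto simp: layer_def funpow_p_fixed)

text \<open>Layers are cumulative because \<open>p\<close> fixes the centre:
  \<open>layer x j\<close> has all vertices of depth at most \<open>j\<close>, and
  \<open>layer x (2 * k)\<close> is the whole cell.\<close>

lemma layer_mono:
  assumes "x \<in> X" "i \<le> j" shows "layer x i \<subseteq> layer x j"
proof
  fix v assume "v \<in> layer x i"
  then have "v \<in> V" "(p ^^ (j - i + i)) v = x"
    using assms(1) by (auto simp: layer_def funpow_add funpow_p_fixed simp del: le_add_diff_inverse2)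
  then show "v \<in> layer x j" using assms(2) by (simp add: layer_def)
qed

(* Inside a cell every edge joins a vertex to its parent, so each non-root vertex of S
   and each non-root vertex of S' accounts for at most one pair. *)
lemma degree_sum_bound:
  assumes deg: "\<And>v. v \<in> V \<Longrightarrow> d \<le> card (A `` {v})" and x: "x \<in> S" "x \<in> S'" "x \<in> X"
    and S: "S \<subseteq> layer x (2 * k)" "S' \<subseteq> layer x (2 * k)"
  shows "d * card S + 2 \<le> card S + card S' + card {(v, u) \<in> A. v \<in> S \<and> u \<notin> S'}"
proof -
  let ?O = "{(v, u) \<in> A. v \<in> S \<and> u \<notin> S'}"
  \<comment> \<open>\<open>?P\<close> collects the pairs leading from a vertex to its parent,
    \<open>?Q\<close> those leading from a parent to its child; the root \<open>x\<close> has no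
    parent edge.\<close>
  let ?P = "(\<lambda>v. (v, p v)) ` (S - {x})" and ?Q = "(\<lambda>u. (p u, u)) ` (S' - {x})"
  have fin: "finite S" "finite S'" using S finite_layer finite_subset by metis+
  have finA: "finite A" using adj_subset[OF G] finite_V by (meson finite_SigmaI finite_subset)
  have "?O \<subseteq> A" by auto
  then have finO: "finite ?O" using finA finite_subset by blast
  have SV: "v \<in> V" if "v \<in> S" for v using S(1) that by (auto simp: layer_def)
  have nb: "finite (A `` {v})" for v using finite_V A_in_V by (auto intro: finite_subset[of _ V])
  have "Sigma S (\<lambda>v. A `` {v}) \<subseteq> ?P \<union> ?Q \<union> ?O"
  proof (rule subsetI, rule ccontr)
    fix z assume "z \<in> Sigma S (\<lambda>v. A `` {v})" and out: "z \<notin> ?P \<union> ?Q \<union> ?O"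
    then obtain v u where v: "v \<in> S" and vu: "(v, u) \<in> A" and z: "z = (v, u)" by auto
    have "u \<in> S'" using out v vu z by blast
    then have "centre u = x" "centre v = x" using v S by (auto simp: layer_def centre_def)
    then have "(v, u) \<in> forest" using edge_in_cell[OF vu] by simp
    then consider "v \<notin> X" "u = p v" | "u \<notin> X" "v = p u" by (auto simp: forest_def)
    then show False
    proof cases
      case 1 then show ?thesis using out v x z by auto
    next
      case 2 then show ?thesis using out \<open>u \<in> S'\<close> x z by auto
    qed
  qed
  then have "card (Sigma S (\<lambda>v. A `` {v})) \<le> card (?P \<union> ?Q \<union> ?O)"
    using fin finO by (intro card_mono) auto
  also have "\<dots> \<le> card (?P \<union> ?Q) + card ?O" by (rule card_Un_le)
  also have "\<dots> \<le> card ?P + card ?Q + card ?O" by (simp add: card_Un_le)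
  also have "\<dots> \<le> card (S - {x}) + card (S' - {x}) + card ?O"
    using fin by (intro add_mono card_image_le) auto
  finally have "card (Sigma S (\<lambda>v. A `` {v})) \<le> card (S - {x}) + card (S' - {x}) + card ?O" .
  moreover have "d * card S \<le> card (Sigma S (\<lambda>v. A `` {v}))"
    using sum_bounded_below[of S d "\<lambda>v. card (A `` {v})"] deg SV fin nb by (simp add: mult.commute)
  moreover have "card S = Suc (card (S - {x}))" "card S' = Suc (card (S' - {x}))"
    using card.remove[OF fin(1) x(1)] card.remove[OF fin(2) x(2)] .
  ultimately show ?thesis by linarith
qed

text \<open>\<open>v\<close> is within distance \<open>j\<close> of \<open>x\<close>, so
  \<open>u\<close> is within \<open>Suc j \<le> k\<close> and \<open>p_ball\<close> applies.\<close>

lemma layer_step: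
  assumes "x \<in> X" "j < k" "v \<in> layer x j" "(v, u) \<in> A"
  shows "u \<in> layer x (Suc j)"
proof -
  have "sym (forest\<^sup>=)" using forest_sym by (auto simp: sym_def)
  then have "(x, v) \<in> (forest\<^sup>=) ^^ j"
    using symD[OF sym_relpow walk_to_iterate[of v j]] assms(3) by (auto simp: layer_def)
  then have "(x, v) \<in> (A\<^sup>=) ^^ j" by (rule relpow_reflcl_mono[OF _ order_refl forest_subset])
  then have "(x, u) \<in> (A\<^sup>=) ^^ Suc j" using assms(4) by auto
  then show ?thesis using p_ball[OF assms(1), of "Suc j" u] assms(2,4) A_in_V by (auto simp: layer_def)
qed

text \<open>The Moore bound for balls, multiplied by \<open>e = d - 2\<close> to avoid division. No
  edge leaves \<open>layer x j\<close> past the next layer, so the degree sum gives the recursion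
  \<open>(d - 1) * m + 2 \<le> n\<close> for consecutive sizes.\<close>

lemma layer_growth:
  assumes deg: "\<And>v. v \<in> V \<Longrightarrow> e + 2 \<le> card (A `` {v})" and x: "x \<in> X" and "j \<le> k"
  shows "(e + 2) * (e + 1) ^ j \<le> e * card (layer x j) + 2"
  using assms(3)
proof (induction j)
  case 0
  have "1 \<le> card (layer x 0)"
    using centre_in_layer[OF x] finite_layer by (metis One_nat_def Suc_leI card_gt_0_iff empty_iff)
  then have "e * 1 \<le> e * card (layer x 0)" by (intro mult_le_mono) auto
  then show ?case by simp
next
  case (Suc j)
  let ?m = "card (layer x j)" and ?n = "card (layer x (Suc j))"
  have "{(v, u) \<in> A. v \<in> layer x j \<and> u \<notin> layer x (Suc j)} = {}"
    using layer_step[OF x] Suc.prems by fastforce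
  then have no_exit: "card {(v, u) \<in> A. v \<in> layer x j \<and> u \<notin> layer x (Suc j)} = 0"
    by (simp only: card.empty)
  have "layer x j \<subseteq> layer x (2 * k)" "layer x (Suc j) \<subseteq> layer x (2 * k)"
    using layer_mono[OF x] Suc.prems by simp_all
  from degree_sum_bound[OF deg centre_in_layer[OF x] centre_in_layer[OF x] x this]
  have "(e + 2) * ?m + 2 \<le> ?m + ?n" unfolding no_exit by simp
  then have "(e + 1) * ?m + 2 \<le> ?n" by (simp add: algebra_simps)
  then have "e * ((e + 1) * ?m + 2) \<le> e * ?n" by (rule mult_le_mono2)
  moreover have "(e + 2) * (e + 1) ^ Suc j \<le> (e + 1) * (e * ?m + 2)"
  proof -
    have "(e + 1) * ((e + 2) * (e + 1) ^ j) \<le> (e + 1) * (e * ?m + 2)"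
      by (rule mult_le_mono2) (use Suc in simp)
    then show ?thesis by (simp only: power_Suc mult.left_commute)
  qed
  ultimately show ?case by (simp add: algebra_simps)
qed

text \<open>With both sets equal to the cell, the degree sum yields at least
  \<open>e * card ?C + 2\<close> leaving edges, the very quantity bounded in
  \<open>layer_growth\<close>. Edges leaving the cell lead to different cells.\<close>

lemma quot_degree:
  assumes deg: "\<And>v. v \<in> V \<Longrightarrow> e + 2 \<le> card (A `` {v})" and x: "x \<in> X"
  shows "(e + 2) * (e + 1) ^ k \<le> card (quot `` {x})"
proof -
  let ?C = "layer x (2 * k)"
  let ?O = "{(v, u) \<in> A. v \<in> ?C \<and> u \<notin> ?C}"
  have O: "(v, u) \<in> A \<and> centre v = x \<and> centre u \<noteq> x" if "(v, u) \<in> ?O" for v u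
    using that A_in_V by (auto simp: layer_def centre_def)
  have "inj_on (\<lambda>(v, u). centre u) ?O"
  proof (rule inj_onI)
    fix z z' assume *: "z \<in> ?O" "z' \<in> ?O" "(\<lambda>(v, u). centre u) z = (\<lambda>(v, u). centre u) z'"
    obtain v u v' u' where z: "z = (v, u)" "z' = (v', u')" by (cases z, cases z')
    have "v = v' \<and> u = u'"
      by (rule edge_between_cells_unique) (use O[of v u] O[of v' u'] * z in auto)
    then show "z = z'" using z by simp
  qed
  moreover have "(\<lambda>(v, u). centre u) ` ?O \<subseteq> quot `` {x}"
  proof
    fix c assume "c \<in> (\<lambda>(v, u). centre u) ` ?O"
    then obtain v u where vu: "(v, u) \<in> ?O" and c: "c = centre u" by auto
    from O[OF vu] show "c \<in> quot `` {x}" unfolding c by (auto simp: quot_def)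
  qed
  moreover have "finite (quot `` {x})"
    by (rule finite_subset[OF _ finite_subset[OF X_subset finite_V]]) (use quot_subset in auto)
  ultimately have "card ?O \<le> card (quot `` {x})" by (rule card_inj_on_le)
  moreover have "(e + 2) * card ?C + 2 \<le> card ?C + card ?C + card ?O"
    by (rule degree_sum_bound[OF deg centre_in_layer[OF x] centre_in_layer[OF x] x]) auto
  then have "e * card ?C + 2 \<le> card ?O" by (simp only: add_mult_distrib mult_2)
  moreover have "card (layer x k) \<le> card ?C"
    by (intro card_mono finite_layer layer_mono x) simp
  then have "e * card (layer x k) \<le> e * card ?C" by (rule mult_le_mono2)
  ultimately show ?thesis using layer_growth[OF deg x order_refl] by linarith
qed

lemma quot_c3_c4_free:
  assumes "\<And>v. v \<in> V \<Longrightarrow> e + 2 \<le> card (A `` {v})"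
  shows "c3_c4_free quot X ((e + 2) * (e + 1) ^ k)"
proof
  show "finite X" using X_subset finite_V by (rule finite_subset)
  show "quot \<subseteq> X \<times> X" by (rule quot_subset)
  show "sym quot" by (rule sym_quot)
  show "(x, x) \<notin> quot" for x by (simp add: quot_def)
  show "(x, z) \<notin> quot" if "(x, y) \<in> quot" "(y, z) \<in> quot" for x y z
    using that by (rule quot_no_triangle)
  show "x = z \<or> y = t" if "(x, y) \<in> quot" "(y, z) \<in> quot" "(z, t) \<in> quot" "(t, x) \<in> quot" for x y z t
    using that by (rule quot_no_c4)
  show "(e + 2) * (e + 1) ^ k \<le> card (quot `` {x})" if "x \<in> X" for x
    using quot_degree[OF assms that] by simp
  have "2 * 1 \<le> (e + 2) * (e + 1) ^ k" by (intro mult_le_mono) auto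
  then show "2 \<le> (e + 2) * (e + 1) ^ k" by simp
qed

(* With the unique edge between the first and the last cell deleted, a shortest path
   between its ends has to run through all the cells one after the other. *)
lemma lift_chordless_cycle:
  assumes c: "chordless_cycle quot cs"
  shows "\<exists>ps. chordless_cycle A ps \<and> length cs \<le> length ps"
proof -
  let ?L = "length cs"
  have L: "3 \<le> ?L" and dist: "distinct cs"
    and q: "\<And>i j. i < j \<Longrightarrow> j < ?L \<Longrightarrow> (cs ! i, cs ! j) \<in> quot \<longleftrightarrow> j = Suc i \<or> i = 0 \<and> Suc j = ?L"
    using c by (auto simp: chordless_cycle_def)
  have "(cs ! 0, cs ! (?L - 1)) \<in> quot"
    using q[of 0 "?L - 1"] L by (subst q) linarith+
  then obtain b a where ba: "(b, a) \<in> A" "centre b = cs ! 0" "centre a = cs ! (?L - 1)"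
    and ne: "centre b \<noteq> centre a" by (auto simp: quot_def)
  define S where "S = {v. centre v \<in> set cs}"
  \<comment> \<open>Only the cells on the cycle are kept, without the edge joining the first and the
    last.\<close>
  define R where "R = A \<inter> S \<times> S - {(a, b), (b, a)}"
  have "cs ! 0 \<in> set cs" "cs ! (?L - 1) \<in> set cs" by (rule nth_mem; use L in linarith)+
  then have bS: "b \<in> S" "a \<in> S" by (simp_all only: S_def mem_Collect_eq ba)
  have forest_R: "(u, v) \<in> R" if "(u, v) \<in> forest" "u \<in> S" for u v
    using that forest_subset forest_centre[OF that(1)] ne by (auto simp: R_def S_def)
  have cell_R: "(u, v) \<in> R\<^sup>*" if "(u, v) \<in> (forest\<^sup>=) ^^ n" "u \<in> S" for u v n
  proof -
    have "v \<in> S \<and> (u, v) \<in> R\<^sup>*" using that(1)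
    proof (induction n arbitrary: v)
      case (Suc n)
      then obtain w where w: "(u, w) \<in> (forest\<^sup>=) ^^ n" "(w, v) \<in> forest\<^sup>=" by auto
      then have IH: "w \<in> S" "(u, w) \<in> R\<^sup>*" using Suc.IH by auto
      show ?case
      proof (cases "w = v")
        case False
        then have "(w, v) \<in> R" using w forest_R IH by blast
        then have "v \<in> S" by (simp add: R_def)
        moreover have "(u, v) \<in> R\<^sup>*" using IH(2) \<open>(w, v) \<in> R\<close> by (rule rtrancl_into_rtrancl)
        ultimately show ?thesis by blast
      qed (use IH in simp)
    qed (use that(2) in simp)
    then show ?thesis by blast
  qed
  have reach: "\<forall>v\<in>V. centre v = cs ! i \<longrightarrow> (b, v) \<in> R\<^sup>*" if "i < ?L" for i
    using that
  proof (induction i)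
    case 0
    then show ?case using cell_R[OF walk_in_cell bS(1)] A_in_V(1)[OF ba(1)] ba(2) by auto
  next
    case (Suc i)
    have "(cs ! i, cs ! Suc i) \<in> quot" using q[of i "Suc i"] Suc.prems by simp
    then obtain u w where uw: "(u, w) \<in> A" "centre u = cs ! i" "centre w = cs ! Suc i"
      by (auto simp: quot_def)
    have "(b, u) \<in> R\<^sup>*" using Suc uw A_in_V by auto
    have wS: "u \<in> S" "w \<in> S" using uw Suc.prems by (auto simp: S_def)
    \<comment> \<open>The deleted edge joins the cells with indices 0 and \<open>?L - 1\<close>;
      consecutive indices \<open>i\<close>, \<open>Suc i\<close> never form this pair, as
      \<open>?L\<close> is at least 3.\<close>
    have "cs ! i \<noteq> cs ! (?L - 1)" "i = 0 \<Longrightarrow> cs ! Suc i \<noteq> cs ! (?L - 1)" "cs ! Suc i \<noteq> cs ! 0"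
      using nth_eq_iff_index_eq[OF dist, of i "?L - 1"] nth_eq_iff_index_eq[OF dist, of "Suc i" "?L - 1"]
        nth_eq_iff_index_eq[OF dist, of "Suc i" 0] Suc.prems L by linarith+
    moreover have "i \<noteq> 0 \<Longrightarrow> cs ! i \<noteq> cs ! 0"
      using nth_eq_iff_index_eq[OF dist, of i 0] Suc.prems by linarith
    ultimately have "(u, w) \<notin> {(a, b), (b, a)}" using uw ba by (cases "i = 0") auto
    then have "(u, w) \<in> R" using uw wS by (auto simp: R_def)
    with \<open>(b, u) \<in> R\<^sup>*\<close> have "(b, w) \<in> R\<^sup>*" by (rule rtrancl_into_rtrancl)
    then show ?case
      using cell_R[OF walk_in_cell wS(2)] uw A_in_V by (metis rtrancl_trans)
  qed
  have "(b, a) \<in> R\<^sup>*" using reach[of "?L - 1"] ba A_in_V L by auto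
  then obtain n where n: "(b, a) \<in> R ^^ n" using rtrancl_imp_relpow by blast
  have ab: "a \<noteq> b" "(b, a) \<notin> R" using ne by (auto simp: R_def)
  have un: "R \<union> {(a, b), (b, a)} = A \<inter> S \<times> S" using ba bS A_sym by (auto simp: R_def)
  show ?thesis
  proof (rule closing_edge_chordless_cycle[OF n ab])
    fix ps assume ps: "chordless_cycle (R \<union> {(a, b), (b, a)}) ps" "ps ! 0 = b" "last ps = a"
      and step: "\<forall>i. Suc i < length ps \<longrightarrow> (ps ! i, ps ! Suc i) \<in> R"
    have len: "3 \<le> length ps" using ps(1) by (simp add: chordless_cycle_def)
    have inS: "ps ! i \<in> S" if "i < length ps" for i
    proof (cases i)
      case (Suc j)
      then show ?thesis using step that by (auto simp: R_def)
    qed (use ps(2) bS in simp)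
    \<comment> \<open>All vertices of \<open>ps\<close> lie in \<open>S\<close>, so a chord in
      \<open>A\<close> would already be one in \<open>A \<inter> S \<times> S\<close>.\<close>
    have "chordless_cycle A ps"
      using ps(1) inS unfolding chordless_cycle_def un by (auto dest: less_trans)
    \<comment> \<open>The cell index rises by at most one per step, so reaching the last cell takes
      at least \<open>?L - 1\<close> steps.\<close>
    moreover have "\<exists>j\<le>i. j < ?L \<and> centre (ps ! i) = cs ! j" if "i < length ps" for i
      using that
    proof (induction i)
      case 0
      then show ?case using ps(2) ba(2) L by auto
    next
      case (Suc i)
      then obtain j where j: "j \<le> i" "j < ?L" "centre (ps ! i) = cs ! j" by auto
      have st: "(ps ! i, ps ! Suc i) \<in> R" using step Suc.prems by blast
      obtain j' where j': "j' < ?L" "centre (ps ! Suc i) = cs ! j'"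
        using inS[OF Suc.prems] by (auto simp: S_def in_set_conv_nth)
      have "j' \<le> Suc j"
      proof (rule ccontr)
        assume "\<not> ?thesis"
        then have jj: "j < j'" "j' \<noteq> Suc j" by auto
        then have "cs ! j \<noteq> cs ! j'" using dist j j' by (simp add: nth_eq_iff_index_eq)
        then have "(cs ! j, cs ! j') \<in> quot" using st j j' by (auto simp: quot_def R_def)
        \<comment> \<open>A larger jump follows the closing edge of the quotient cycle, whose only
          lift is the deleted edge.\<close>
        then have "j = 0" "j' = ?L - 1" using q[OF jj(1) j'(1)] jj(2) by auto
        then have "centre (ps ! i) = centre b" "centre (ps ! Suc i) = centre a"
          using j j' ba by auto
        then have "ps ! i = b" "ps ! Suc i = a"
          using edge_between_cells_unique[of "ps ! i" "ps ! Suc i" b a] st ba ne by (auto simp: R_def)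
        then show False using st by (simp add: R_def)
      qed
      then show ?case using j j' by (intro exI[of _ j']) auto
    qed
    moreover have "length ps - 1 < length ps" using len by linarith
    ultimately have "chordless_cycle A ps"
      "\<exists>j\<le>length ps - 1. j < ?L \<and> centre (ps ! (length ps - 1)) = cs ! j" by blast+
    then obtain j where j: "j \<le> length ps - 1" "j < ?L" "centre (ps ! (length ps - 1)) = cs ! j" by blast
    then have "centre a = cs ! j" using ps(3) len last_conv_nth[of ps] by (cases ps) auto
    then have "j = ?L - 1" using ba(3) dist j(2) L by (simp add: nth_eq_iff_index_eq)
    then have "?L \<le> length ps" using j(1) len by linarith
    with \<open>chordless_cycle A ps\<close> show ?thesis by blast
  qed
qed

end

section \<open>Existence of the cells\<close>

lemma ex_cells:
  assumes G: "simple_graph V E" and g: "enat (16 * k + 5) \<le> girth V E" and ne: "V \<noteq> {}"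
  shows "\<exists>X p. cells V E k X p \<and> X \<noteq> {}"
proof -
  define B where "B n = ((adj E)\<^sup>=) ^^ n" for n :: nat
  have symB: "(x, y) \<in> B n \<Longrightarrow> (y, x) \<in> B n" for x y n
  proof -
    have "sym ((adj E)\<^sup>=)" using symD[OF sym_adj] by (auto simp: sym_def)
    from symD[OF sym_relpow[OF this]] show "(x, y) \<in> B n \<Longrightarrow> (y, x) \<in> B n" by (simp only: B_def)
  qed
  have mono: "(x, y) \<in> B m \<Longrightarrow> m \<le> n \<Longrightarrow> (x, y) \<in> B n" for x y m n
    unfolding B_def by (rule relpow_reflcl_mono) auto
  have finV: "finite V" using G by (simp add: simple_graph_def)
  let ?P = "{X. X \<subseteq> V \<and> (\<forall>x\<in>X. \<forall>y\<in>X. (x, y) \<in> B (2 * k) \<longrightarrow> x = y)}"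
  have "finite ?P" "?P \<noteq> {}" using finV by auto
  from finite_has_maximal[OF this]
  obtain X where X: "X \<in> ?P" "\<forall>Y\<in>?P. X \<subseteq> Y \<longrightarrow> X = Y" by (elim bexE)
  have XV: "X \<subseteq> V" and pack: "\<And>x y. x \<in> X \<Longrightarrow> y \<in> X \<Longrightarrow> (x, y) \<in> B (2 * k) \<Longrightarrow> x = y"
    using X(1) by auto
  \<comment> \<open>By maximality: a vertex farther than \<open>2 * k\<close> from all centres could
    be added to \<open>X\<close>.\<close>
  have cover: "\<exists>x\<in>X. (v, x) \<in> B (2 * k)" if v: "v \<in> V" for v
  proof (rule ccontr)
    assume no: "\<not> ?thesis"
    have "x = y" if "x \<in> insert v X" "y \<in> insert v X" "(x, y) \<in> B (2 * k)" for x y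
      using that no pack symB[of x y] by auto
    then have "insert v X \<in> ?P" using v XV by (intro CollectI conjI ballI impI) simp_all
    from bspec[OF X(2) this] have "v \<in> X" by (metis insertI1 subset_insertI)
    moreover have "(v, v) \<in> B (2 * k)" using mono[of v v 0] by (simp add: B_def)
    ultimately show False using no by blast
  qed
  \<comment> \<open>The distance to the nearest centre; \<open>cover\<close> makes it meaningful on
    \<open>V\<close>.\<close>
  define \<delta> where "\<delta> v = (LEAST n. \<exists>x\<in>X. (v, x) \<in> B n)" for v
  have \<delta>_le: "\<delta> v \<le> n" if "x \<in> X" "(v, x) \<in> B n" for v x n
    unfolding \<delta>_def by (rule Least_le) (use that in blast)
  have \<delta>: "\<exists>x\<in>X. (v, x) \<in> B (\<delta> v)" if "v \<in> V" for v
    unfolding \<delta>_def by (rule LeastI_ex) (use cover[OF that] in blast)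
  have closer: "\<exists>u. (v, u) \<in> adj E \<and> \<delta> u < \<delta> v" if v: "v \<in> V" "v \<notin> X" for v
  proof -
    obtain x where x: "x \<in> X" "(v, x) \<in> B (\<delta> v)" using \<delta> v by blast
    then have "\<delta> v \<noteq> 0" using v by (intro notI) (simp add: B_def)
    then obtain m where m: "\<delta> v = Suc m" using not0_implies_Suc by blast
    then obtain u where u: "(v, u) \<in> (adj E)\<^sup>=" "(u, x) \<in> B m"
      using x(2) unfolding B_def by (metis relpow_Suc_D2)
    then have "\<delta> u < \<delta> v" using \<delta>_le[OF x(1) u(2)] m by simp
    then show ?thesis using u by blast
  qed
  define p where "p v = (if v \<in> X then v else SOME u. (v, u) \<in> adj E \<and> \<delta> u < \<delta> v)" for v
  have pX: "p v = v" if "v \<in> X" for v using that by (simp add: p_def)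
  have p: "(v, p v) \<in> adj E" "\<delta> (p v) < \<delta> v" if "v \<in> V" "v \<notin> X" for v
    using someI_ex[OF closer[OF that]] that(2) by (simp_all add: p_def)
  have pV: "p v \<in> V" if "v \<in> V" for v
    using that pX p(1)[OF that] adj_subset[OF G] by (cases "v \<in> X") auto
  have iter: "(p ^^ n) v \<in> X" if "v \<in> V" "\<delta> v \<le> n" for n v
    using that
  proof (induction n arbitrary: v)
    case 0
    then show ?case using \<delta>[of v] by (auto simp: B_def)
  next
    case (Suc n)
    have "\<delta> (p v) \<le> n"
    proof (cases "v \<in> X")
      case True
      then have "\<delta> v \<le> 0" using \<delta>_le[of v v 0] by (simp add: B_def)
      then show ?thesis using pX[OF True] by simp
    next
      case False
      then show ?thesis using p(2)[OF Suc.prems(1)] Suc.prems(2) by simp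
    qed
    then have "(p ^^ n) (p v) \<in> X" using Suc.IH pV Suc.prems by blast
    then show ?case by (simp only: funpow_Suc_right o_apply)
  qed
  have walk: "(v, (p ^^ n) v) \<in> B n" if "v \<in> V" for v n
    using funpow_walk[of V p "(adj E)\<^sup>="] that pV p(1) pX unfolding B_def by (metis Un_iff pair_in_Id_conv)
  have "cells V E k X p"
  proof
    show "(p ^^ (2 * k)) v \<in> X" if "v \<in> V" for v
      using iter[OF that] cover[OF that] \<delta>_le by blast
  next
    fix x j v assume x: "x \<in> X" and j: "j \<le> k" and xv: "(x, v) \<in> ((adj E)\<^sup>=) ^^ j"
    have v: "v \<in> V" using relpow_reflcl_stays[OF adj_subset[OF G] xv] x XV by blast
    have xvB: "(x, v) \<in> B j" using xv by (simp add: B_def)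
    \<comment> \<open>\<open>p\<close> decreases the distance to \<open>X\<close>, so after
      \<open>j\<close> steps a centre is reached. It is within \<open>2 * j\<close> of
      \<open>x\<close>, and the separation of the centres makes it equal to
      \<open>x\<close>.\<close>
    have y: "(p ^^ j) v \<in> X" using iter[OF v \<delta>_le[OF x symB[OF xvB]]] .
    have "(x, (p ^^ j) v) \<in> B (j + j)" using xvB walk[OF v] unfolding B_def by (rule relpow_comp)
    then have "(x, (p ^^ j) v) \<in> B (2 * k)" by (rule mono) (use j in simp)
    then show "(p ^^ j) v = x" using pack[OF x y] by simp
  qed (use G g XV pX p in auto)
  moreover have "X \<noteq> {}" using cover ne by blast
  ultimately show ?thesis by blast
qed

section \<open>Length bounds for graphs of large girth\<close>

lemma ex_long_induced_cycle:
  assumes G: "simple_graph V E" and ne: "V \<noteq> {}" and g: "enat (16 * k + 5) \<le> girth V E"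
    and d: "2 \<le> min_degree V E"
  shows "\<exists>xs. is_induced_cycle V E xs \<and>
    3 + min_degree V E * (min_degree V E - 1) ^ k \<le> length xs"
proof -
  obtain e where e: "min_degree V E = e + 2" using d by (metis le_add_diff_inverse2)
  obtain X p where "cells V E k X p" and X: "X \<noteq> {}" using ex_cells[OF G g ne] by blast
  then interpret cells V E k X p by simp
  have "e + 2 \<le> card (adj E `` {v})" if "v \<in> V" for v
  proof -
    have "min_degree V E \<le> degree E v" using that finite_V by (simp add: min_degree_def)
    then show ?thesis using degree_eq_card_adj[OF G] e by metis
  qed
  then interpret Q: c3_c4_free quot X "(e + 2) * (e + 1) ^ k" by (rule quot_c3_c4_free)
  obtain cs where cs: "chordless_cycle quot cs" "(e + 2) * (e + 1) ^ k + 3 \<le> length cs"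
    using Q.ex_long_chordless_cycle[OF X] by blast
  obtain ps where ps: "chordless_cycle (adj E) ps" "length cs \<le> length ps"
    using lift_chordless_cycle[OF cs(1)] by blast
  have "3 + min_degree V E * (min_degree V E - 1) ^ k \<le> length ps" using cs(2) ps(2) e by simp
  then show ?thesis using chordless_cycle_is_induced_cycle[OF G ps(1)] by blast
qed

text \<open>The factor 1/2 comes from \<open>d \<le> 2 * (d - 1)\<close> for \<open>d\<close> at
  least 2, and \<open>(d - 1) ^ k\<close> is at least \<open>d - 1\<close> for positive
  \<open>k\<close>.\<close>

lemma ex_quadratic_induced_cycle:
  assumes G: "simple_graph V E" and ne: "V \<noteq> {}" and g: "enat (16 * k + 5) \<le> girth V E"
    and d: "2 \<le> min_degree V E" and k: "1 \<le> k"
  shows "\<exists>xs. is_induced_cycle V E xs \<and> 1 / 2 * (real (min_degree V E))\<^sup>2 \<le> real (length xs)"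
proof -
  let ?d = "min_degree V E"
  obtain xs where xs: "is_induced_cycle V E xs" "3 + ?d * (?d - 1) ^ k \<le> length xs"
    using ex_long_induced_cycle[OF G ne g d] by blast
  have "?d - 1 \<le> (?d - 1) ^ k" using d k by (intro self_le_power) auto
  then have "?d * (?d - 1) \<le> ?d * (?d - 1) ^ k" by (rule mult_le_mono2)
  then have "?d * (?d - 1) \<le> length xs" using xs(2) by linarith
  moreover have "?d * ?d \<le> 2 * (?d * (?d - 1))"
  proof -
    have "?d \<le> 2 * (?d - 1)" using d by simp
    from mult_le_mono2[OF this, of ?d] show ?thesis by (simp add: ac_simps)
  qed
  ultimately have "?d * ?d \<le> 2 * length xs" by linarith
  then have "real (?d * ?d) \<le> real (2 * length xs)" by (rule of_nat_mono)
  then have "1 / 2 * (real ?d)\<^sup>2 \<le> real (length xs)" by (simp add: power2_eq_square)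
  then show ?thesis using xs(1) by blast
qed

theorem theorem14:
  "(\<forall>(k::nat) (d::nat) (V :: 'a set) E.
      simple_graph V E \<and> V \<noteq> {} \<and> enat (16 * k + 5) \<le> girth V E
        \<and> min_degree V E = d \<and> 2 \<le> d
      \<longrightarrow> (\<exists>xs. is_induced_cycle V E xs \<and> 3 + d * (d - 1) ^ k \<le> length xs))
   \<and>
   (\<exists>c::real. c > 0 \<and>
      (\<forall>(k::nat) (d::nat) (V :: nat set) E.
        1 \<le> k \<and> simple_graph V E \<and> V \<noteq> {} \<and> enat (16 * k + 5) \<le> girth V E
          \<and> min_degree V E = d \<and> 2 \<le> d
        \<longrightarrow> (\<exists>xs. is_induced_cycle V E xs \<and> c * (real d)^2 \<le> real (length xs))) \<and>
      (\<forall>(k::nat) (d::nat) (V :: 'a set) E.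
        1 \<le> k \<and> simple_graph V E \<and> V \<noteq> {} \<and> enat (16 * k + 5) \<le> girth V E
          \<and> min_degree V E = d \<and> 2 \<le> d
        \<longrightarrow> (\<exists>xs. is_induced_cycle V E xs \<and> c * (real d)^2 \<le> real (length xs))))"
proof (intro conjI exI[of _ "1 / 2 :: real"] allI impI)
  \<comment> \<open>The same constant serves both vertex types, since the quadratic bound is
    polymorphic.\<close>
  show "0 < (1 / 2 :: real)" by simp
qed (elim conjE, hypsubst, rule ex_long_induced_cycle ex_quadratic_induced_cycle; assumption)+

end
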